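(* Let $F$ be $L$-smooth and $l$-lower smooth on $\Omega$, $\theta_0\in\Omega$, and let $\theta^*$ be a minimizer of $F$ over $\Omega$. Consider the NCGS algorithm (defined in the context) run for $N$ iterations, either with option I and $\alpha_k=\frac2{k+1}$, $\beta_k=\frac1{2L}$, $\lambda_k=\beta_k$, $\eta_k=\frac1N$, or with option II and $\alpha_k=\frac2{k+1}$, $\beta_k=\frac1{2L}$, $\lambda_k=\frac{k\beta_k}2$, $\eta_k=\chi_k=\frac1N$. Then, in either option, to achieve accuracy $\epsilon$ the FO complexity is $\mathcal{O}(1/\epsilon)$ and the LO complexity is $\mathcal{O}(1/\epsilon^2)$. That is, there is a constant $C$ not depending on $\epsilon$ such that for every $\epsilon\in(0,1]$ there is a choice of $N$ for which the algorithm makes at most $C/\epsilon$ calls to FO and at most $C/\epsilon^2$ calls to LO, and $$\min_{k=1,\dots,N}\|g(\theta_{k-1},\nabla F(\theta_k^{md}),\lambda_k)\|^2\le\epsilon\ \text{ (option I)},\qquad \min_{k=1,\dots,N}\|g(\theta_k^{md},\nabla F(\theta_k^{md}),\beta_k)\|^2\le\epsilon\ \text{ (option II)}.$$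
   Context: Setting: $\Omega\subset\mathbb{R}^p$ is nonempty, compact and convex; $F:\mathbb{R}^p\to\mathbb{R}$ is differentiable and possibly non-convex; norms are Euclidean. The constant $C$ may depend on the problem data $L$, $l$, $M$, $\Omega$, $F$, $\theta_0$, $\theta^*$. $F$ is $L$-smooth ($L>0$) on $\Omega$ if $\|\nabla F(\theta_1)-\nabla F(\theta_2)\|\le L\|\theta_1-\theta_2\|$ for all $\theta_1,\theta_2\in\Omega$. $F$ is $l$-lower smooth ($l\ge 0$) if $-\frac{l}{2}\|\theta_1-\theta_2\|^2\le F(\theta_1)-F(\theta_2)-\langle\nabla F(\theta_2),\theta_1-\theta_2\rangle$ for all $\theta_1,\theta_2\in\Omega$. For $x,\omega\in\mathbb{R}^p$ and $\gamma>0$: $\psi(x,\omega,\gamma)=\arg\min_{\theta\in\Omega}\langle\omega,\theta\rangle+\frac{1}{2\gamma}\|\theta-x\|^2$, and the gradient mapping is $g(x,\omega,\gamma)=\frac1\gamma\big(x-\psi(x,\omega,\gamma)\big)$. The constant $M$ satisfies $\|\psi(x,\omega,\gamma)\|\le M$ for all $x\in\Omega$, $\omega\in\mathbb{R}^p$, $\gamma\in(0,\infty)$. Oracles: a call to FO (first order oracle) returns $\nabla F(\theta)$ at a queried $\theta$; a call to LO (linear oracle) returns an element of $\arg\min_{\theta\in\Omega}\langle\theta,w\rangle$ for a queried vector $w$. Complexity means number of calls needed to obtain accuracy $\epsilon$. Procedure $u^+=condg(w,u,\lambda,\eta)$, for $w\in\mathbb{R}^p$, $u\in\Omega$, $\lambda,\eta>0$: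 set $u_1=u$. For $t=1,2,\dots$: let $v_t\in\Omega$ attain $V(u_t)=\max_{x\in\Omega}\langle w+\frac1\lambda(u_t-u),u_t-x\rangle$ (one LO call); if $V(u_t)\le\eta$, return $u^+=u_t$ and stop; otherwise set $u_{t+1}=(1-\xi_t)u_t+\xi_tv_t$ with $\xi_t=\min\Big\{1,\frac{\langle\frac1\lambda(u-u_t)-w,\,v_t-u_t\rangle}{\frac1\lambda\|v_t-u_t\|^2}\Big\}$. NCGS algorithm: set $\theta_0^{ag}=\theta_0$. For $k=1,\dots,N$: - $\theta_k^{md}=(1-\alpha_k)\theta_{k-1}^{ag}+\alpha_k\theta_{k-1}$, and compute $\nabla F(\theta_k^{md})$ (one FO call); - $\theta_k=condg(\nabla F(\theta_k^{md}),\theta_{k-1},\lambda_k,\eta_k)$; - option I: $\theta_k^{ag}=\theta_k^{md}-\beta_k\frac{\theta_{k-1}-\theta_k}{\lambda_k}$; option II: $\theta_k^{ag}=condg(\nabla F(\theta_k^{md}),\theta_k^{md},\beta_k,\chi_k)$. *)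

theory Defs
  imports
    "HOL-Analysis.Analysis"
    "HOL-Library.While_Combinator"
    "HOL-Library.Monad_Syntax"
begin

definition grad :: "('a::real_inner \<Rightarrow> real) \<Rightarrow> 'a \<Rightarrow> 'a" where
  "grad F x = (THE D. GDERIV F x :> D)"

lemma gderiv_grad:
  fixes F :: "'a::euclidean_space \<Rightarrow> real"
  assumes "F differentiable (at x)"
  shows "GDERIV F x :> grad F x"
proof -
  from assms obtain F' where F': "(F has_derivative F') (at x)"
    unfolding differentiable_def by blast
  define D where "D = adjoint F' 1"
  have "F' h = h \<bullet> D" for h
    using adjoint_works[OF has_derivative_linear[OF F'], of h 1] by (simp add: D_def)
  then have D: "GDERIV F x :> D"
    using F' unfolding gderiv_def by presburger
  have "E = D" if "GDERIV F x :> E" for E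
  proof -
    have "(\<lambda>h. h \<bullet> E) = (\<lambda>h. h \<bullet> D)"
      using that D unfolding gderiv_def by (rule has_derivative_unique)
    then show "E = D"
      by (metis vector_eq_ldot)
  qed
  with D show ?thesis
    unfolding grad_def by (rule theI)
qed

definition smooth_on :: "real \<Rightarrow> 'a::real_inner set \<Rightarrow> ('a \<Rightarrow> real) \<Rightarrow> bool" where
  "smooth_on L \<Omega> F \<longleftrightarrow>
    (\<forall>x\<in>\<Omega>. \<forall>y\<in>\<Omega>. norm (grad F x - grad F y) \<le> L * norm (x - y))"

definition lower_smooth_on :: "real \<Rightarrow> 'a::real_inner set \<Rightarrow> ('a \<Rightarrow> real) \<Rightarrow> bool" where
  "lower_smooth_on l \<Omega> F \<longleftrightarrow>
    (\<forall>x\<in>\<Omega>. \<forall>y\<in>\<Omega>. - (l / 2) * (norm (x - y))\<^sup>2 \<le> F x - F y - grad F y \<bullet> (x - y))"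

definition prox :: "'a::real_inner set \<Rightarrow> 'a \<Rightarrow> 'a \<Rightarrow> real \<Rightarrow> 'a" where
  "prox \<Omega> x \<omega> \<gamma> = arg_min_on (\<lambda>\<theta>. \<omega> \<bullet> \<theta> + 1 / (2 * \<gamma>) * (norm (\<theta> - x))\<^sup>2) \<Omega>"

definition grad_map :: "'a::real_inner set \<Rightarrow> 'a \<Rightarrow> 'a \<Rightarrow> real \<Rightarrow> 'a" where
  "grad_map \<Omega> x \<omega> \<gamma> = (1 / \<gamma>) *\<^sub>R (x - prox \<Omega> x \<omega> \<gamma>)"

(* LO n w is the answer to query w when n oracle calls were made before it.  The dependence on n
   allows repeated queries to receive different minimizers, so that quantifying over LO covers
   every possible choice of the points v_t along a run. *)
definition linear_oracle :: "'a::real_inner set \<Rightarrow> (nat \<Rightarrow> 'a \<Rightarrow> 'a) \<Rightarrow> bool" where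
  "linear_oracle \<Omega> LO \<longleftrightarrow> (\<forall>n w. is_arg_min (\<lambda>\<theta>. \<theta> \<bullet> w) (\<lambda>\<theta>. \<theta> \<in> \<Omega>) (LO n w))"

(* The quantity V(x); for compact nonempty \<Omega> the supremum is a maximum, and it is attained
   at every minimizer over \<Omega> of the linear function given by w + (x - u) / lam. *)
definition condg_gap :: "'a::real_inner set \<Rightarrow> 'a \<Rightarrow> 'a \<Rightarrow> real \<Rightarrow> 'a \<Rightarrow> real" where
  "condg_gap \<Omega> w u lam x = (SUP y\<in>\<Omega>. (w + (1 / lam) *\<^sub>R (x - u)) \<bullet> (x - y))"

(* Given the number n of linear oracle calls made so far, returns the output point together with
   the updated number of calls, or None if the loop does not terminate.  The call answered in the
   last round, where only the stopping test is performed, accounts for the final increment. *)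
definition condg ::
  "'a::real_inner set \<Rightarrow> (nat \<Rightarrow> 'a \<Rightarrow> 'a) \<Rightarrow> 'a \<Rightarrow> 'a \<Rightarrow> real \<Rightarrow> real \<Rightarrow> nat \<Rightarrow> ('a \<times> nat) option"
where
  "condg \<Omega> LO w u lam \<eta> n =
    map_option (\<lambda>(x, m). (x, m + 1))
      (while_option
        (\<lambda>(x, m). condg_gap \<Omega> w u lam x > \<eta>)
        (\<lambda>(x, m).
          let v = LO m (w + (1 / lam) *\<^sub>R (x - u));
              \<xi> = min 1 ((((1 / lam) *\<^sub>R (u - x) - w) \<bullet> (v - x)) / ((1 / lam) * (norm (v - x))\<^sup>2))
          in ((1 - \<xi>) *\<^sub>R x + \<xi> *\<^sub>R v, m + 1))
        (u, n))"

(* Option_II carries the tolerances \<chi>_k, which option I does not use. *)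
datatype ag_rule = Option_I | Option_II "nat \<Rightarrow> real"

record 'a ncgs_state =
  it_theta :: 'a
  it_ag :: 'a
  it_md :: 'a
  fo_calls :: nat
  lo_calls :: nat

definition ncgs_step ::
  "('a::real_inner \<Rightarrow> 'a) \<Rightarrow> (nat \<Rightarrow> 'a \<Rightarrow> 'a) \<Rightarrow> 'a set \<Rightarrow> ag_rule \<Rightarrow>
   (nat \<Rightarrow> real) \<Rightarrow> (nat \<Rightarrow> real) \<Rightarrow> (nat \<Rightarrow> real) \<Rightarrow> (nat \<Rightarrow> real) \<Rightarrow>
   nat \<Rightarrow> 'a ncgs_state \<Rightarrow> 'a ncgs_state option"
where
  "ncgs_step FO LO \<Omega> rule \<alpha> \<beta> lam \<eta> k s =
    do {
      let md = (1 - \<alpha> k) *\<^sub>R it_ag s + \<alpha> k *\<^sub>R it_theta s;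
      let w = FO md;
      (th, m) \<leftarrow> condg \<Omega> LO w (it_theta s) (lam k) (\<eta> k) (lo_calls s);
      (ag, n) \<leftarrow>
        (case rule of
          Option_I \<Rightarrow> Some (md - \<beta> k *\<^sub>R ((1 / lam k) *\<^sub>R (it_theta s - th)), m)
        | Option_II tol \<Rightarrow> condg \<Omega> LO w md (\<beta> k) (tol k) m);
      Some \<lparr>it_theta = th, it_ag = ag, it_md = md, fo_calls = fo_calls s + 1, lo_calls = n\<rparr>
    }"

(* The state after k iterations, or None if some inner loop did not terminate.  The component
   it_md of the initial state is a dummy value. *)
primrec ncgs ::
  "('a::real_inner \<Rightarrow> 'a) \<Rightarrow> (nat \<Rightarrow> 'a \<Rightarrow> 'a) \<Rightarrow> 'a set \<Rightarrow> ag_rule \<Rightarrow>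
   (nat \<Rightarrow> real) \<Rightarrow> (nat \<Rightarrow> real) \<Rightarrow> (nat \<Rightarrow> real) \<Rightarrow> (nat \<Rightarrow> real) \<Rightarrow>
   'a \<Rightarrow> nat \<Rightarrow> 'a ncgs_state option"
where
  "ncgs FO LO \<Omega> rule \<alpha> \<beta> lam \<eta> \<theta>0 0 =
    Some \<lparr>it_theta = \<theta>0, it_ag = \<theta>0, it_md = \<theta>0, fo_calls = 0, lo_calls = 0\<rparr>"
| "ncgs FO LO \<Omega> rule \<alpha> \<beta> lam \<eta> \<theta>0 (Suc k) =
    do {
      s \<leftarrow> ncgs FO LO \<Omega> rule \<alpha> \<beta> lam \<eta> \<theta>0 k;
      ncgs_step FO LO \<Omega> rule \<alpha> \<beta> lam \<eta> (Suc k) s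
    }"

end

theory Submission
  imports Defs
begin

text \<open>With option I the three sequences collapse to one, \<open>\<theta>\<^sub>k\<^sup>m\<^sup>d = \<theta>\<^sub>k\<^sub>-\<^sub>1\<close> and \<open>\<theta>\<^sub>k\<^sup>a\<^sup>g = \<theta>\<^sub>k\<close>. In both
  options \<open>\<theta>\<^sub>k\<^sup>a\<^sup>g\<close> is therefore an inexact projected gradient step from \<open>\<theta>\<^sub>k\<^sup>m\<^sup>d\<close>, which lowers \<open>F\<close> by a
  multiple of the squared gradient mapping up to an error of order \<open>1 / N\<close>, while passing from
  \<open>\<theta>\<^sub>k\<^sub>-\<^sub>1\<^sup>a\<^sup>g\<close> to \<open>\<theta>\<^sub>k\<^sup>m\<^sup>d\<close> raises \<open>F\<close> by at most a multiple of \<open>\<alpha>\<^sub>k \<le> 2 / k\<close>, because \<open>\<Omega>\<close> is bounded.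
  Weighting the \<open>k\<close>-th descent inequality by \<open>k\<close> makes these errors sum to a multiple of \<open>N\<close>, against
  a total weight of order \<open>N\<^sup>2\<close>; hence the smallest squared gradient mapping is of order \<open>1 / N\<close>.
  Every inner Frank-Wolfe loop stops within a multiple of \<open>N\<close> linear oracle calls.\<close>

section \<open>Termination by a real-valued ranking, and scalar estimates for Frank-Wolfe
  steps\<close>

text \<open>Each round costs the nonnegative rank \<open>r\<close> at least 1, so induction on a
  natural number above \<open>r s\<close> ends the loop. The real-valued rank lets the Frank-Wolfe
  potential serve directly.\<close>

lemma while_option_ranking:
  fixes r :: "'s \<Rightarrow> real"
  assumes step: "\<And>s. I s \<Longrightarrow> b s \<Longrightarrow> I (c s) \<and> r (c s) + 1 \<le> r s"
    and nonneg: "\<And>s. I s \<Longrightarrow> 0 \<le> r s"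
    and "I s"
  shows "\<exists>t. while_option b c s = Some t \<and> I t \<and> \<not> b t"
proof -
  have "\<exists>t. while_option b c s = Some t \<and> I t \<and> \<not> b t" if "I s" "r s < real j" for j s
    using that
  proof (induction j arbitrary: s)
    case 0
    then show ?case using nonneg[of s] by simp
  next
    case (Suc j)
    show ?case
    proof (cases "b s")
      case True
      with step[OF Suc.prems(1)] Suc.prems(2) have "I (c s)" "r (c s) < real j"
        by auto
      from Suc.IH[OF this] True show ?thesis
        by (simp add: while_option_unfold[of b c s])
    next
      case False
      with Suc.prems show ?thesis by (simp add: while_option_unfold[of b c s])
    qed
  qed
  with \<open>I s\<close> reals_Archimedean2[of "r s"] show ?thesis by blast
qed

text \<open>As a function of \<open>h\<close> this is the concave function vanishing at \<open>0\<close> whose derivative is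
  \<open>2 K / (max h \<eta>)\<^sup>2\<close>. A Frank-Wolfe step decreases the suboptimality \<open>h\<close> by at least
  \<open>(max h \<eta>)\<^sup>2 / (2 K)\<close>, hence this potential by at least \<open>1\<close>.\<close>

definition fw_potential :: "real \<Rightarrow> real \<Rightarrow> real \<Rightarrow> real" where
  "fw_potential K \<eta> h = 2 * K * (if h < \<eta> then h / \<eta>\<^sup>2 else 2 / \<eta> - 1 / h)"

lemma fw_potential_nonneg:
  assumes "0 < K" "0 < \<eta>" "0 \<le> h"
  shows "0 \<le> fw_potential K \<eta> h"
proof -
  have "1 / h \<le> 2 / \<eta>" if "\<not> h < \<eta>"
    using that assms by (auto simp: field_simps)
  with assms show ?thesis by (auto simp: fw_potential_def)
qed

text \<open>The slope \<open>2 * K / h\<^sup>2\<close> is integrable at infinity, so the potential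
  is bounded independently of \<open>h\<close>. The step count thus needs no estimate of the initial
  suboptimality.\<close>

lemma fw_potential_le:
  assumes "0 < K" "0 < \<eta>"
  shows "fw_potential K \<eta> h \<le> 4 * K / \<eta>"
proof -
  have "h / \<eta>\<^sup>2 \<le> 2 / \<eta>" if "h < \<eta>"
    using that assms by (auto simp: field_simps power2_eq_square)
  moreover have "0 \<le> 1 / h" if "\<not> h < \<eta>"
    using that assms by auto
  ultimately have "(if h < \<eta> then h / \<eta>\<^sup>2 else 2 / \<eta> - 1 / h) \<le> 2 / \<eta>"
    by auto
  then have "2 * K * (if h < \<eta> then h / \<eta>\<^sup>2 else 2 / \<eta> - 1 / h) \<le> 2 * K * (2 / \<eta>)"
    using assms by (intro mult_left_mono) auto
  then show ?thesis by (simp add: fw_potential_def)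
qed

text \<open>By concavity the potential drops over \<open>[h', h]\<close> by at least
  \<open>h - h'\<close> times its slope at \<open>h\<close>, which is
  \<open>2 * K / (max h \<eta>)\<^sup>2\<close>; the assumed decrease makes this product at least
  1.\<close>

lemma fw_potential_decrease:
  assumes "0 < K" "0 < \<eta>" "0 \<le> h'" and dec: "h' \<le> h - (max h \<eta>)\<^sup>2 / (2 * K)"
  shows "fw_potential K \<eta> h' + 1 \<le> fw_potential K \<eta> h"
proof -
  define m where "m = max h \<eta>"
  have m: "0 < m" "\<eta> \<le> m" using assms by (auto simp: m_def)
  have le: "1 \<le> 2 * K * ((h - h') / m\<^sup>2)"
    using dec m \<open>0 < K\<close> by (simp add: m_def[symmetric] field_simps)
  have "h' \<le> h" using dec \<open>0 < K\<close> by (smt (verit) divide_nonneg_pos zero_le_power2)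
  define p where "p h = (if h < \<eta> then h / \<eta>\<^sup>2 else 2 / \<eta> - 1 / h)" for h
  have "(h - h') / m\<^sup>2 \<le> p h - p h'"
  proof (cases "h < \<eta>")
    case True
    with \<open>h' \<le> h\<close> show ?thesis by (simp add: p_def m_def diff_divide_distrib)
  next
    case False
    then have "m = h" "0 < h" using \<open>0 < \<eta>\<close> by (auto simp: m_def)
    show ?thesis
    proof (cases "h' < \<eta>")
      case True
      have "1 / h \<le> 1 / \<eta>" using False \<open>0 < \<eta>\<close> by (simp add: frac_le)
      moreover have "h' * (1 / \<eta> + 1 / h) \<le> 2"
      proof -
        have "h' / \<eta> \<le> 1" "h' / h \<le> 1" using True False \<open>0 < \<eta>\<close> \<open>0 < h\<close> by auto
        then show ?thesis by (simp add: algebra_simps)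
      qed
      \<comment> \<open>With \<open>h'\<close> on the linear branch and \<open>h\<close> on the
        hyperbolic one, the slack in the tangent inequality factors into this product; both factors
        are nonnegative because \<open>h' < \<eta> \<le> h\<close>.\<close>
      ultimately have "0 \<le> (1 / \<eta> - 1 / h) * (2 - h' * (1 / \<eta> + 1 / h))"
        by (intro mult_nonneg_nonneg) auto
      also have "\<dots> = (2 / \<eta> - 1 / h - h' / \<eta>\<^sup>2) - (h - h') / h\<^sup>2"
        using \<open>0 < \<eta>\<close> \<open>0 < h\<close> by (simp add: field_simps power2_eq_square)
      finally show ?thesis using True False \<open>m = h\<close> by (simp add: p_def)
    next
      case h': False
      then have "0 < h'" using \<open>0 < \<eta>\<close> by simp
      have "(h - h') / h\<^sup>2 \<le> (h - h') / (h * h')"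
        using \<open>h' \<le> h\<close> \<open>0 < h\<close> \<open>0 < h'\<close> by (intro divide_left_mono) (auto simp: power2_eq_square)
      also have "\<dots> = 1 / h' - 1 / h" using \<open>0 < h\<close> \<open>0 < h'\<close> by (simp add: field_simps)
      finally show ?thesis using h' False \<open>m = h\<close> by (simp add: p_def)
    qed
  qed
  then have "2 * K * ((h - h') / m\<^sup>2) \<le> 2 * K * (p h - p h')"
    using \<open>0 < K\<close> by (intro mult_left_mono) auto
  with le show ?thesis by (simp add: fw_potential_def p_def right_diff_distrib)
qed

text \<open>For \<open>V \<le> a\<close> the truncation is inactive and completing the square leaves
  the slack \<open>a / 2 * (s - \<xi>)\<^sup>2\<close>. Otherwise the parabola is decreasing on
  \<open>[0, 1]\<close>, so the endpoint 1 is best.\<close>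

lemma quadratic_line_search:
  fixes a V s :: real
  assumes "0 < a" "0 \<le> s" "s \<le> 1"
  defines "\<xi> \<equiv> min 1 (V / a)"
  shows "- \<xi> * V + \<xi>\<^sup>2 / 2 * a \<le> - s * V + s\<^sup>2 / 2 * a"
proof (cases "V \<le> a")
  case True
  then have "\<xi> = V / a" using assms by (auto simp: min_def)
  then have "V = a * \<xi>" using assms by simp
  have "0 \<le> a / 2 * (s - \<xi>)\<^sup>2" using assms by simp
  then show ?thesis unfolding \<open>V = a * \<xi>\<close> by (simp add: algebra_simps power2_eq_square)
next
  case False
  then have "\<xi> = 1" using assms by (auto simp: min_def)
  have "(1 + s) * a \<le> 2 * a" using \<open>0 < a\<close> \<open>s \<le> 1\<close> by (intro mult_right_mono) auto
  then have "0 \<le> (1 - s) * (V - (1 + s) * a / 2)" using \<open>s \<le> 1\<close> False by (intro mult_nonneg_nonneg) auto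
  also have "\<dots> = (- s * V + s\<^sup>2 / 2 * a) - (- \<xi> * V + \<xi>\<^sup>2 / 2 * a)"
    unfolding \<open>\<xi> = 1\<close> by (simp add: power2_eq_square field_simps)
  finally show ?thesis by simp
qed

subsection \<open>The conditional gradient procedure\<close>

abbreviation prox_obj :: "'a::real_inner \<Rightarrow> 'a \<Rightarrow> real \<Rightarrow> 'a \<Rightarrow> real" where
  "prox_obj w u lam x \<equiv> w \<bullet> x + 1 / (2 * lam) * (norm (x - u))\<^sup>2"

text \<open>The objective is quadratic, so its second-order Taylor expansion at \<open>x\<close> is
  exact. It serves both as the formula for a step and as strong convexity.\<close>

lemma prox_obj_expand:
  assumes "0 < lam"
  shows "prox_obj w u lam y = prox_obj w u lam x + (w + (1 / lam) *\<^sub>R (x - u)) \<bullet> (y - x)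
    + 1 / (2 * lam) * (norm (y - x))\<^sup>2"
proof -
  have "(norm (y - u))\<^sup>2 = (norm (x - u))\<^sup>2 + 2 * ((x - u) \<bullet> (y - x)) + (norm (y - x))\<^sup>2"
    unfolding power2_norm_eq_inner by (simp add: algebra_simps inner_commute)
  then have "1 / (2 * lam) * (norm (y - u))\<^sup>2 =
      1 / (2 * lam) * (norm (x - u))\<^sup>2 + (1 / lam) * ((x - u) \<bullet> (y - x)) + 1 / (2 * lam) * (norm (y - x))\<^sup>2"
    using assms by (simp add: add_divide_distrib)
  then show ?thesis
    by (simp add: inner_add_left inner_diff_right[of w])
qed

lemma prox_obj_attains_min:
  fixes \<Omega> :: "'a::euclidean_space set"
  assumes "compact \<Omega>" "\<Omega> \<noteq> {}" "0 < lam"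
  shows "\<exists>p\<in>\<Omega>. \<forall>x\<in>\<Omega>. prox_obj w u lam p \<le> prox_obj w u lam x"
  using assms by (intro continuous_attains_inf) (auto intro!: continuous_intros)

lemma prox_minimizes:
  fixes \<Omega> :: "'a::euclidean_space set"
  assumes "compact \<Omega>" "\<Omega> \<noteq> {}" "0 < lam"
  shows "prox \<Omega> u w lam \<in> \<Omega>"
    and "x \<in> \<Omega> \<Longrightarrow> prox_obj w u lam (prox \<Omega> u w lam) \<le> prox_obj w u lam x"
proof -
  obtain p where "is_arg_min (prox_obj w u lam) (\<lambda>x. x \<in> \<Omega>) p"
    using prox_obj_attains_min[OF assms, of w u] by (auto simp: is_arg_min_linorder)
  then have "is_arg_min (prox_obj w u lam) (\<lambda>x. x \<in> \<Omega>) (prox \<Omega> u w lam)"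
    unfolding prox_def arg_min_on_def arg_min_def by (rule someI)
  then show "prox \<Omega> u w lam \<in> \<Omega>"
    and "x \<in> \<Omega> \<Longrightarrow> prox_obj w u lam (prox \<Omega> u w lam) \<le> prox_obj w u lam x"
    by (auto simp: is_arg_min_linorder)
qed

text \<open>The stopping test of \<open>condg\<close> without the supremum, ready to be instantiated
  with a chosen competitor: the exact prox point or the centre \<open>u\<close>.\<close>

definition approx_prox :: "'a::real_inner set \<Rightarrow> 'a \<Rightarrow> 'a \<Rightarrow> real \<Rightarrow> real \<Rightarrow> 'a \<Rightarrow> bool" where
  "approx_prox \<Omega> w u lam \<eta> x \<longleftrightarrow>
    x \<in> \<Omega> \<and> (\<forall>y\<in>\<Omega>. (w + (1 / lam) *\<^sub>R (x - u)) \<bullet> (x - y) \<le> \<eta>)"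

text \<open>Strong convexity turns a small gap into a small distance. Expanding at \<open>x\<close>
  instead of at the prox point reduces the input to the comparison of two objective values.\<close>

lemma approx_prox_dist:
  fixes \<Omega> :: "'a::euclidean_space set"
  assumes "compact \<Omega>" "0 < lam" and x: "approx_prox \<Omega> w u lam \<eta> x"
  shows "(norm (x - prox \<Omega> u w lam))\<^sup>2 \<le> 2 * lam * \<eta>"
proof -
  let ?p = "prox \<Omega> u w lam"
  let ?g = "w + (1 / lam) *\<^sub>R (x - u)"
  have "x \<in> \<Omega>" using x by (simp add: approx_prox_def)
  then have "\<Omega> \<noteq> {}" by blast
  note prox = prox_minimizes[OF \<open>compact \<Omega>\<close> this \<open>0 < lam\<close>, where u = u and w = w]
  have p: "?p \<in> \<Omega>" "prox_obj w u lam ?p \<le> prox_obj w u lam x"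
    by (fact prox(1), fact prox(2)[OF \<open>x \<in> \<Omega>\<close>])
  have "?g \<bullet> (?p - x) \<ge> - \<eta>"
    using x p(1) by (auto simp: approx_prox_def inner_diff_right)
  with p(2) prox_obj_expand[OF \<open>0 < lam\<close>, where w = w and u = u and y = ?p and x = x]
  have "1 / (2 * lam) * (norm (?p - x))\<^sup>2 \<le> \<eta>" by linarith
  then show ?thesis using \<open>0 < lam\<close> by (simp add: field_simps norm_minus_commute)
qed

section \<open>Frank-Wolfe steps and the cost of the inner loop\<close>

text \<open>Minimizing \<open>g \<bullet> y\<close> maximizes \<open>g \<bullet> (x - y)\<close>, so
  every answer of the oracle attains the supremum, whatever the call number
  \<open>m\<close>.\<close>

lemma condg_gap_eq:
  fixes \<Omega> :: "'a::real_inner set" and w u x y :: 'a and lam :: real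
  assumes "linear_oracle \<Omega> LO"
  defines "g \<equiv> w + (1 / lam) *\<^sub>R (x - u)"
  shows "LO m g \<in> \<Omega>"
    and "condg_gap \<Omega> w u lam x = g \<bullet> (x - LO m g)"
    and "y \<in> \<Omega> \<Longrightarrow> g \<bullet> (x - y) \<le> condg_gap \<Omega> w u lam x"
proof -
  have v: "LO m g \<in> \<Omega>" "\<And>y. y \<in> \<Omega> \<Longrightarrow> LO m g \<bullet> g \<le> y \<bullet> g"
    using assms by (auto simp: linear_oracle_def is_arg_min_linorder)
  show "LO m g \<in> \<Omega>" by (fact v(1))
  have le: "g \<bullet> (x - y) \<le> g \<bullet> (x - LO m g)" if "y \<in> \<Omega>" for y
    using v(2)[OF that] by (simp add: inner_diff_right inner_commute)
  show eq: "condg_gap \<Omega> w u lam x = g \<bullet> (x - LO m g)"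
    unfolding condg_gap_def g_def[symmetric]
    by (rule cSup_eq_maximum) (use v(1) le in auto)
  show "g \<bullet> (x - y) \<le> condg_gap \<Omega> w u lam x" if "y \<in> \<Omega>"
    using le[OF that] eq by simp
qed

text \<open>\<open>K\<close> dominates both the gap \<open>V\<close> and the curvature
  \<open>a\<close> along the step. Hence \<open>V / K\<close> is an admissible step length; it gains
  at least \<open>V\<^sup>2 / (2 * K)\<close>, and the exact line search does no worse.\<close>

lemma condg_step_decrease:
  fixes \<Omega> :: "'a::real_inner set" and w u x :: 'a and lam :: real and m :: nat
  assumes "convex \<Omega>" and LO: "linear_oracle \<Omega> LO" and "0 < lam"
    and D: "\<And>x y. x \<in> \<Omega> \<Longrightarrow> y \<in> \<Omega> \<Longrightarrow> norm (x - y) \<le> D" and G: "norm w \<le> G"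
    and K: "D\<^sup>2 / lam + G * D \<le> K" "0 < K"
    and "u \<in> \<Omega>" "x \<in> \<Omega>" and gap: "0 < condg_gap \<Omega> w u lam x"
  defines "v \<equiv> LO m (w + (1 / lam) *\<^sub>R (x - u))"
  defines "\<xi> \<equiv> min 1 ((((1 / lam) *\<^sub>R (u - x) - w) \<bullet> (v - x)) / ((1 / lam) * (norm (v - x))\<^sup>2))"
  defines "x' \<equiv> (1 - \<xi>) *\<^sub>R x + \<xi> *\<^sub>R v"
  shows "x' \<in> \<Omega>"
    and "prox_obj w u lam x' \<le> prox_obj w u lam x - (condg_gap \<Omega> w u lam x)\<^sup>2 / (2 * K)"
proof -
  define g where "g = w + (1 / lam) *\<^sub>R (x - u)"
  define V where "V = condg_gap \<Omega> w u lam x"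
  define a where "a = (norm (v - x))\<^sup>2 / lam"
  have v: "v \<in> \<Omega>" and V: "V = g \<bullet> (x - v)"
    using condg_gap_eq[OF LO] by (auto simp: v_def V_def g_def)
  have "V > 0" using gap by (simp add: V_def)
  then have "v \<noteq> x" using V by auto
  then have "0 < a" using \<open>0 < lam\<close> by (simp add: a_def)
  \<comment> \<open>The numerator of \<open>\<xi>\<close> is the gap itself, and the positive gap
    has excluded \<open>v = x\<close>, so the quotient is a genuine one.\<close>
  have \<xi>: "\<xi> = min 1 (V / a)"
    by (simp add: \<xi>_def a_def V g_def inner_diff_left inner_diff_right inner_add_left algebra_simps)
  then have \<xi>01: "0 \<le> \<xi>" "\<xi> \<le> 1" using \<open>0 < V\<close> \<open>0 < a\<close> by auto
  show "x' \<in> \<Omega>"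
    using convexD[OF \<open>convex \<Omega>\<close> \<open>x \<in> \<Omega>\<close> v, of "1 - \<xi>" \<xi>] \<xi>01 by (simp add: x'_def)
  have normD: "norm (v - x) \<le> D" "norm (x - u) \<le> D" "norm (x - v) \<le> D"
    using D v \<open>x \<in> \<Omega>\<close> \<open>u \<in> \<Omega>\<close> by auto
  have "0 \<le> D" using normD(1) norm_ge_zero order_trans by blast
  have "0 \<le> G" using G norm_ge_zero order_trans by blast
  have "V \<le> norm g * norm (x - v)" unfolding V by (rule norm_cauchy_schwarz)
  also have "\<dots> \<le> (G + D / lam) * D"
  proof (intro mult_mono)
    have "norm g \<le> norm w + norm (x - u) / lam"
      unfolding g_def using norm_triangle_ineq[of w "(1 / lam) *\<^sub>R (x - u)"] \<open>0 < lam\<close> by simp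
    also have "\<dots> \<le> G + D / lam"
      using G normD \<open>0 < lam\<close> by (intro add_mono divide_right_mono) auto
    finally show "norm g \<le> G + D / lam" .
  qed (use normD \<open>0 \<le> G\<close> \<open>0 \<le> D\<close> \<open>0 < lam\<close> in auto)
  also have "\<dots> \<le> K" using K(1) by (simp add: algebra_simps power2_eq_square)
  finally have "V \<le> K" .
  have "a \<le> D\<^sup>2 / lam"
    unfolding a_def using normD \<open>0 < lam\<close> by (intro divide_right_mono power_mono) auto
  also have "\<dots> \<le> K" using K(1) mult_nonneg_nonneg[OF \<open>0 \<le> G\<close> \<open>0 \<le> D\<close>] by linarith
  finally have "a \<le> K" .
  have x'x: "x' - x = \<xi> *\<^sub>R (v - x)" by (simp add: x'_def algebra_simps)
  have "prox_obj w u lam x' = prox_obj w u lam x + (- \<xi> * V + \<xi>\<^sup>2 / 2 * a)"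
    unfolding prox_obj_expand[OF \<open>0 < lam\<close>, where w = w and u = u and y = x' and x = x] g_def[symmetric] x'x
    using \<open>0 < lam\<close> by (simp add: V a_def inner_diff_right power_mult_distrib right_diff_distrib)
  also have "\<dots> \<le> prox_obj w u lam x + (- (V / K) * V + (V / K)\<^sup>2 / 2 * a)"
    unfolding \<xi> using \<open>0 < a\<close> \<open>0 < V\<close> \<open>V \<le> K\<close> \<open>0 < K\<close>
    by (intro add_left_mono quadratic_line_search) auto
  also have "\<dots> \<le> prox_obj w u lam x + (- (V / K) * V + (V / K)\<^sup>2 / 2 * K)"
    using \<open>a \<le> K\<close> by (intro add_left_mono mult_left_mono) auto
  also have "\<dots> = prox_obj w u lam x - V\<^sup>2 / (2 * K)"
  proof -
    have "- (V / K) * V + (V / K)\<^sup>2 / 2 * K = - (V\<^sup>2 / (2 * K))"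
      using \<open>0 < K\<close> by (simp add: field_simps power2_eq_square)
    then show ?thesis by linarith
  qed
  finally show "prox_obj w u lam x' \<le> prox_obj w u lam x - (condg_gap \<Omega> w u lam x)\<^sup>2 / (2 * K)"
    unfolding V_def .
qed

text \<open>The ranking is the potential of the suboptimality \<open>h\<close>. It starts at most at
  \<open>4 * K / \<eta>\<close>, which bounds the number of steps; the extra 1 is the call of the
  final stopping test.\<close>

lemma condg_terminates:
  fixes \<Omega> :: "'a::euclidean_space set"
  assumes "compact \<Omega>" "convex \<Omega>" and LO: "linear_oracle \<Omega> LO" and "0 < lam" "0 < \<eta>"
    and D: "\<And>x y. x \<in> \<Omega> \<Longrightarrow> y \<in> \<Omega> \<Longrightarrow> norm (x - y) \<le> D" and G: "norm w \<le> G"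
    and K: "D\<^sup>2 / lam + G * D \<le> K" "0 < K"
    and "u \<in> \<Omega>"
  shows "\<exists>x m. condg \<Omega> LO w u lam \<eta> n = Some (x, m) \<and> approx_prox \<Omega> w u lam \<eta> x \<and>
    real m \<le> real n + 4 * K / \<eta> + 1"
proof -
  obtain p where p: "p \<in> \<Omega>" "\<And>x. x \<in> \<Omega> \<Longrightarrow> prox_obj w u lam p \<le> prox_obj w u lam x"
    using prox_obj_attains_min[OF \<open>compact \<Omega>\<close> _ \<open>0 < lam\<close>, of w u] \<open>u \<in> \<Omega>\<close> by blast
  define h where "h x = prox_obj w u lam x - prox_obj w u lam p" for x
  have h_nonneg: "0 \<le> h x" if "x \<in> \<Omega>" for x
    using p(2)[OF that] by (simp add: h_def)
  let ?V = "condg_gap \<Omega> w u lam"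
  have h_le: "h x \<le> ?V x" for x
  proof -
    have "0 \<le> 1 / (2 * lam) * (norm (p - x))\<^sup>2" using \<open>0 < lam\<close> by simp
    with prox_obj_expand[OF \<open>0 < lam\<close>, where w = w and u = u and y = p and x = x]
    have "h x \<le> - ((w + (1 / lam) *\<^sub>R (x - u)) \<bullet> (p - x))"
      unfolding h_def by linarith
    also have "\<dots> = (w + (1 / lam) *\<^sub>R (x - u)) \<bullet> (x - p)"
      by (simp add: inner_diff_right)
    also have "\<dots> \<le> ?V x" by (rule condg_gap_eq(3)[OF LO p(1)])
    finally show ?thesis .
  qed
  define b where "b = (\<lambda>(x, m :: nat). ?V x > \<eta>)"
  define c where "c = (\<lambda>(x, m).
          let v = LO m (w + (1 / lam) *\<^sub>R (x - u));
              \<xi> = min 1 ((((1 / lam) *\<^sub>R (u - x) - w) \<bullet> (v - x)) / ((1 / lam) * (norm (v - x))\<^sup>2))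
          in ((1 - \<xi>) *\<^sub>R x + \<xi> *\<^sub>R v, m + 1))"
  \<comment> \<open>Each step adds 1 to the call count and removes at least 1 from the potential, so
    their sum never grows; at exit this bounds the count.\<close>
  define I where "I = (\<lambda>(x, m). x \<in> \<Omega> \<and> real m + fw_potential K \<eta> (h x) \<le> real n + 4 * K / \<eta>)"
  define r where "r = (\<lambda>(x, m :: nat). fw_potential K \<eta> (h x))"
  have "\<exists>t. while_option b c (u, n) = Some t \<and> I t \<and> \<not> b t"
  proof (rule while_option_ranking[where r = r])
    fix s assume "I s" "b s"
    obtain x m where s: "s = (x, m)" by (cases s)
    obtain x' where x': "c s = (x', m + 1)" by (auto simp: c_def s Let_def)
    have x: "x \<in> \<Omega>" "\<eta> < ?V x" "0 < ?V x"
      using \<open>I s\<close> \<open>b s\<close> \<open>0 < \<eta>\<close> by (auto simp: I_def b_def s)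
    note step = condg_step_decrease[OF \<open>convex \<Omega>\<close> LO \<open>0 < lam\<close> D G K \<open>u \<in> \<Omega>\<close> x(1,3), of m]
    have "x' \<in> \<Omega>" "prox_obj w u lam x' \<le> prox_obj w u lam x - (?V x)\<^sup>2 / (2 * K)"
      using step x' by (auto simp: c_def s Let_def)
    \<comment> \<open>While the loop runs, the gap exceeds \<open>\<eta>\<close>, and it always
      dominates \<open>h x\<close>. This is why the potential uses the maximum of the two.\<close>
    moreover have "(max (h x) \<eta>)\<^sup>2 / (2 * K) \<le> (?V x)\<^sup>2 / (2 * K)"
      using x h_le[of x] \<open>0 < K\<close> \<open>0 < \<eta>\<close> by (intro divide_right_mono power_mono) auto
    ultimately have "h x' \<le> h x - (max (h x) \<eta>)\<^sup>2 / (2 * K)"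
      unfolding h_def by linarith
    then have "fw_potential K \<eta> (h x') + 1 \<le> fw_potential K \<eta> (h x)"
      using h_nonneg \<open>x' \<in> \<Omega>\<close> K \<open>0 < \<eta>\<close> by (intro fw_potential_decrease) auto
    with \<open>I s\<close> \<open>x' \<in> \<Omega>\<close> show "I (c s) \<and> r (c s) + 1 \<le> r s"
      unfolding x' by (auto simp: s I_def r_def)
  next
    fix s assume "I s"
    then show "0 \<le> r s"
      using fw_potential_nonneg[OF \<open>0 < K\<close> \<open>0 < \<eta>\<close> h_nonneg] by (auto simp: I_def r_def)
  next
    show "I (u, n)"
      using \<open>u \<in> \<Omega>\<close> fw_potential_le[OF \<open>0 < K\<close> \<open>0 < \<eta>\<close>] by (simp add: I_def)
  qed
  then obtain x m where run: "while_option b c (u, n) = Some (x, m)" "I (x, m)" "\<not> b (x, m)"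
    by auto
  have "x \<in> \<Omega>" using run by (simp add: I_def)
  have "approx_prox \<Omega> w u lam \<eta> x"
    unfolding approx_prox_def
  proof (intro conjI ballI)
    fix y assume "y \<in> \<Omega>"
    from condg_gap_eq(3)[OF LO this]
    have "(w + (1 / lam) *\<^sub>R (x - u)) \<bullet> (x - y) \<le> ?V x" .
    also have "?V x \<le> \<eta>" using run(3) by (simp add: b_def)
    finally show "(w + (1 / lam) *\<^sub>R (x - u)) \<bullet> (x - y) \<le> \<eta>" .
  qed fact
  moreover have "real m \<le> real n + 4 * K / \<eta>"
    using run(2) fw_potential_nonneg[OF \<open>0 < K\<close> \<open>0 < \<eta>\<close> h_nonneg[OF \<open>x \<in> \<Omega>\<close>]]
    by (simp add: I_def)
  moreover have "condg \<Omega> LO w u lam \<eta> n = Some (x, m + 1)"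
    using run(1) by (simp add: condg_def b_def c_def)
  ultimately show ?thesis by auto
qed

subsection \<open>Descent estimates\<close>

text \<open>The descent lemma by monotonicity instead of integration: subtracting the linear and
  quadratic terms along the segment leaves a function with nonpositive derivative. Convexity keeps
  the segment inside \<open>\<Omega>\<close>, where smoothness holds.\<close>

lemma smooth_on_upper_bound:
  fixes F :: "'a::euclidean_space \<Rightarrow> real"
  assumes "convex \<Omega>" and diff: "\<And>x. F differentiable (at x)" and smooth: "smooth_on L \<Omega> F"
    and "x \<in> \<Omega>" "y \<in> \<Omega>"
  shows "F y \<le> F x + grad F x \<bullet> (y - x) + L / 2 * (norm (y - x))\<^sup>2"
proof -
  let ?d = "y - x"
  define f where "f t = F (x + t *\<^sub>R ?d) - t * (grad F x \<bullet> ?d) - t\<^sup>2 * (L / 2 * (norm ?d)\<^sup>2)" for t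
  have deriv: "(f has_real_derivative
      grad F (x + t *\<^sub>R ?d) \<bullet> ?d - grad F x \<bullet> ?d - 2 * t * (L / 2 * (norm ?d)\<^sup>2)) (at t)" for t
  proof -
    have "((\<lambda>t. x + t *\<^sub>R ?d) has_derivative (\<lambda>h. h *\<^sub>R ?d)) (at t)"
      by (auto intro!: derivative_eq_intros)
    from has_derivative_compose[OF this gderiv_grad[OF diff, unfolded gderiv_def]]
    have "((\<lambda>t. F (x + t *\<^sub>R ?d)) has_derivative (\<lambda>h. (h *\<^sub>R ?d) \<bullet> grad F (x + t *\<^sub>R ?d))) (at t)" .
    then have "((\<lambda>t. F (x + t *\<^sub>R ?d)) has_real_derivative grad F (x + t *\<^sub>R ?d) \<bullet> ?d) (at t)"
      by (rule has_derivative_imp_has_field_derivative) (simp add: inner_commute)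
    moreover have "((\<lambda>t. t * (grad F x \<bullet> ?d)) has_real_derivative grad F x \<bullet> ?d) (at t)"
      by (auto intro!: derivative_eq_intros)
    moreover have "((\<lambda>t. t\<^sup>2 * (L / 2 * (norm ?d)\<^sup>2)) has_real_derivative
        2 * t * (L / 2 * (norm ?d)\<^sup>2)) (at t)"
      by (rule DERIV_cmult_right) (auto intro!: derivative_eq_intros)
    ultimately show ?thesis unfolding f_def by (intro DERIV_diff)
  qed
  have "f 1 \<le> f 0"
  proof (rule DERIV_nonpos_imp_nonincreasing[where a = 0 and b = 1 and f = f])
    fix t :: real assume t: "0 \<le> t" "t \<le> 1"
    have "x + t *\<^sub>R ?d \<in> \<Omega>"
      using convexD_alt[OF \<open>convex \<Omega>\<close> \<open>x \<in> \<Omega>\<close> \<open>y \<in> \<Omega>\<close> t] by (simp add: algebra_simps)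
    then have "norm (grad F (x + t *\<^sub>R ?d) - grad F x) \<le> L * (t * norm ?d)"
      using smooth \<open>x \<in> \<Omega>\<close> t unfolding smooth_on_def by force
    then have "(grad F (x + t *\<^sub>R ?d) - grad F x) \<bullet> ?d \<le> L * (t * norm ?d) * norm ?d"
      by (intro order_trans[OF norm_cauchy_schwarz] mult_right_mono) auto
    then have "grad F (x + t *\<^sub>R ?d) \<bullet> ?d - grad F x \<bullet> ?d - 2 * t * (L / 2 * (norm ?d)\<^sup>2) \<le> 0"
      unfolding inner_diff_left power2_eq_square by (simp add: mult_ac)
    with deriv show "\<exists>z. (f has_real_derivative z) (at t) \<and> z \<le> 0" by blast
  qed simp
  then show ?thesis by (simp add: f_def)
qed

text \<open>Multiplying step \<open>k\<close> by \<open>k\<close> turns its error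
  \<open>A / k\<close> into \<open>A\<close>; telescoping \<open>k * e k\<close> leaves one surplus
  term \<open>e k \<le> B\<close> per step.\<close>

lemma exists_small_of_descent:
  fixes e d :: "nat \<Rightarrow> real"
  assumes "1 \<le> N" "0 < c" "0 \<le> A" "0 \<le> B" "0 \<le> e N"
    and bound: "\<And>k. k < N \<Longrightarrow> e k \<le> B"
    and step: "\<And>k. k < N \<Longrightarrow> e (Suc k) \<le> e k + A / real (Suc k) - c * d (Suc k)"
  shows "\<exists>k\<in>{1..N}. d k \<le> 2 * (A + B) / (c * real N)"
proof (rule ccontr)
  assume "\<not> ?thesis"
  then have big: "2 * (A + B) / (c * real N) < d k" if "k \<in> {1..N}" for k
    using that by force
  have sum: "real n * e n + c * (\<Sum>k=1..n. real k * d k) \<le> real n * (A + B)" if "n \<le> N" for n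
    using that
  proof (induction n)
    case (Suc n)
    have "real (Suc n) * e (Suc n) \<le> real (Suc n) * (e n + A / real (Suc n) - c * d (Suc n))"
      using step[of n] Suc.prems by (intro mult_left_mono) auto
    also have "\<dots> = real n * e n + e n + A - c * (real (Suc n) * d (Suc n))"
      by (simp add: field_simps)
    finally show ?case
      using Suc.IH Suc.prems bound[of n] by (simp add: algebra_simps)
  qed simp
  \<comment> \<open>The Gauss sum makes the total weight \<open>N * (N + 1) / 2\<close>. If every
    \<open>d k\<close> exceeded \<open>T\<close>, the weighted sum times \<open>c\<close> would
    exceed \<open>(A + B) * (N + 1)\<close>, against the bound \<open>N * (A + B)\<close>.\<close>
  define T where "T = 2 * (A + B) / (c * real N)"
  have "2 * (\<Sum>k=1..N. real k) = real N * (real N + 1)"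
    using double_gauss_sum_from_Suc_0[of N, where ?'a = real] by simp
  then have *: "c * (\<Sum>k=1..N. real k * T) = c * real N * T * (real N + 1) / 2"
    by (simp add: sum_distrib_right[symmetric])
  have "(A + B) * (real N + 1) = c * (\<Sum>k=1..N. real k * T)"
  proof -
    have "c * real N * T = 2 * (A + B)" using assms(1,2) by (simp add: T_def)
    with * show ?thesis by (simp only:)
  qed
  also have "\<dots> < c * (\<Sum>k=1..N. real k * d k)"
    using \<open>1 \<le> N\<close> \<open>0 < c\<close> big[folded T_def] by (intro mult_strict_left_mono sum_strict_mono) auto
  also have "\<dots> \<le> real N * (A + B)"
  proof -
    have "0 \<le> real N * e N" using \<open>0 \<le> e N\<close> by simp
    with sum[OF order_refl] show ?thesis by linarith
  qed
  finally show False using assms by (simp add: algebra_simps)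
qed

subsection \<open>The NCGS iteration\<close>

locale ncgs_problem =
  fixes \<Omega> :: "'a::euclidean_space set" and F :: "'a \<Rightarrow> real" and L G D Fmin B :: real
  assumes compact: "compact \<Omega>" and convex: "convex \<Omega>"
    and diff: "\<And>x. F differentiable (at x)"
    and L_pos: "0 < L" and smooth: "smooth_on L \<Omega> F"
    and G: "\<And>x. x \<in> \<Omega> \<Longrightarrow> norm (grad F x) \<le> G" and G_nonneg: "0 \<le> G"
    and D: "\<And>x y. x \<in> \<Omega> \<Longrightarrow> y \<in> \<Omega> \<Longrightarrow> norm (x - y) \<le> D" and D_nonneg: "0 \<le> D"
    and Fmin: "\<And>x. x \<in> \<Omega> \<Longrightarrow> Fmin \<le> F x" and B: "\<And>x. x \<in> \<Omega> \<Longrightarrow> F x \<le> Fmin + B"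
    and B_nonneg: "0 \<le> B"
begin

text \<open>\<open>K\<close> bounds the Frank-Wolfe gap and the curvature of every subproblem, as all of them have
  step size at least \<open>1 / (4 * L)\<close>.\<close>

definition K where "K = 4 * L * D\<^sup>2 + G * D + 1"

text \<open>Collects the errors of one iteration as a multiple of \<open>1 / k\<close>:
  \<open>5 / 2\<close> from the inexact step with tolerance \<open>1 / N \<le> 1 / k\<close>, the
  rest from the extrapolation, doubled because its weight is at most \<open>2 / k\<close>.\<close>

definition Q where "Q = 5 / 2 + 2 * (G * D) + L * D\<^sup>2"

lemma K_pos: "0 < K"
  using L_pos G_nonneg D_nonneg by (simp add: K_def add_nonneg_pos)

lemma Q_ge: "5 / 2 \<le> Q"
  using L_pos G_nonneg D_nonneg by (simp add: Q_def)

section \<open>Estimates for a single iteration\<close>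

text \<open>Testing the stopping criterion at the centre \<open>x\<close> and adding the descent
  lemma gives a decrease of \<open>3 / 2 * L * d\<close> up to \<open>\<eta>\<close>. The distance
  from \<open>x'\<close> to the exact prox point then converts \<open>d\<close> into the gradient
  mapping, at the price of another \<open>3 / 2 * \<eta>\<close>.\<close>

lemma approx_prox_descent:
  assumes "x \<in> \<Omega>" and x': "approx_prox \<Omega> (grad F x) x (1 / (2 * L)) \<eta> x'"
  shows "F x' \<le> F x + 5 / 2 * \<eta> - 3 / (16 * L) * (norm (grad_map \<Omega> x (grad F x) (1 / (2 * L))))\<^sup>2"
proof -
  define p where "p = prox \<Omega> x (grad F x) (1 / (2 * L))"
  define d where "d = (norm (x' - x))\<^sup>2"
  have "x' \<in> \<Omega>" using x' by (simp add: approx_prox_def)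
  have "(grad F x + (2 * L) *\<^sub>R (x' - x)) \<bullet> (x' - x) \<le> \<eta>"
    using x' \<open>x \<in> \<Omega>\<close> by (auto simp: approx_prox_def)
  then have "grad F x \<bullet> (x' - x) \<le> \<eta> - 2 * L * d"
    by (simp add: inner_add_left d_def power2_norm_eq_inner)
  with smooth_on_upper_bound[OF convex diff smooth \<open>x \<in> \<Omega>\<close> \<open>x' \<in> \<Omega>\<close>]
  have F: "F x' \<le> F x + \<eta> - 3 / 2 * (L * d)"
    by (simp add: d_def)
  have prox: "(norm (x' - p))\<^sup>2 \<le> \<eta> / L"
    using approx_prox_dist[OF compact _ x'] L_pos by (simp add: p_def)
  have "norm (x - p) \<le> norm (x' - x) + norm (x' - p)"
    using norm_triangle_ineq[of "x - x'" "x' - p"] by (simp add: norm_minus_commute)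
  then have "(norm (x - p))\<^sup>2 \<le> (norm (x' - x) + norm (x' - p))\<^sup>2"
    by (intro power_mono) auto
  also have "\<dots> \<le> 2 * d + 2 * (norm (x' - p))\<^sup>2"
    using sum_squares_bound[of "norm (x' - x)" "norm (x' - p)"]
    by (simp add: power2_sum d_def)
  also have "\<dots> \<le> 2 * d + 2 * (\<eta> / L)" using prox by simp
  \<comment> \<open>The factor \<open>3 / 4 * L\<close> makes the \<open>2 * d\<close> match the
    available decrease. The gradient mapping has norm \<open>2 * L * norm (x - p)\<close>, whence
    \<open>3 / (16 * L)\<close>.\<close>
  finally have "3 / 4 * L * (norm (x - p))\<^sup>2 \<le> 3 / 4 * L * (2 * d + 2 * (\<eta> / L))"
    using L_pos by (intro mult_left_mono) auto
  also have "\<dots> = 3 / 2 * (L * d) + 3 / 2 * \<eta>" using L_pos by (simp add: field_simps)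
  also have "3 / 4 * L * (norm (x - p))\<^sup>2 = 3 / (16 * L) * ((2 * L)\<^sup>2 * (norm (x - p))\<^sup>2)"
    using L_pos by (simp add: power2_eq_square)
  also have "(2 * L)\<^sup>2 * (norm (x - p))\<^sup>2 = (norm (grad_map \<Omega> x (grad F x) (1 / (2 * L))))\<^sup>2"
    using L_pos by (simp add: grad_map_def p_def power_mult_distrib)
  finally show ?thesis using F by linarith
qed

text \<open>Controls the possible increase of \<open>F\<close> from the aggregate point to the
  extrapolated one. Since \<open>a\<^sup>2 \<le> a\<close>, the quadratic term is also linear in
  \<open>a\<close>.\<close>

lemma F_extrapolation_le:
  assumes "x \<in> \<Omega>" "y \<in> \<Omega>" "0 \<le> a" "a \<le> 1"
  shows "F ((1 - a) *\<^sub>R x + a *\<^sub>R y) \<le> F x + a * (G * D + L / 2 * D\<^sup>2)"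
proof -
  let ?z = "(1 - a) *\<^sub>R x + a *\<^sub>R y"
  have "?z \<in> \<Omega>" using assms by (intro convexD_alt[OF convex])
  have z: "?z - x = a *\<^sub>R (y - x)" by (simp add: algebra_simps)
  have "grad F x \<bullet> (y - x) \<le> norm (grad F x) * norm (y - x)" by (rule norm_cauchy_schwarz)
  also have "\<dots> \<le> G * D" using G D assms G_nonneg by (intro mult_mono) auto
  finally have "grad F x \<bullet> (?z - x) \<le> a * (G * D)"
    unfolding z using assms by (simp add: mult_left_mono)
  moreover have "L / 2 * (norm (?z - x))\<^sup>2 \<le> L / 2 * (a * D\<^sup>2)"
  proof -
    have "(norm (?z - x))\<^sup>2 = a\<^sup>2 * (norm (y - x))\<^sup>2" unfolding z by (simp add: power_mult_distrib)
    also have "\<dots> \<le> a * D\<^sup>2"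
      using D assms by (intro mult_mono power_mono) (auto simp: power2_eq_square mult_left_le)
    finally show ?thesis using L_pos by (intro mult_left_mono) auto
  qed
  ultimately show ?thesis
    using smooth_on_upper_bound[OF convex diff smooth \<open>x \<in> \<Omega>\<close> \<open>?z \<in> \<Omega>\<close>]
    by (simp add: distrib_left mult.left_commute)
qed

text \<open>The lower bound on \<open>lam\<close> gives
  \<open>D\<^sup>2 / lam \<le> 4 * L * D\<^sup>2\<close>, so one \<open>K\<close> serves all calls;
  the final call is absorbed by \<open>N \<ge> 1\<close>. Gradient point and prox centre are
  separate because they differ in the first call of option II.\<close>

lemma condg_grad_terminates:
  assumes "linear_oracle \<Omega> LO" "x \<in> \<Omega>" "u \<in> \<Omega>" and lam: "1 / (4 * L) \<le> lam" and "1 \<le> N"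
  shows "\<exists>y m. condg \<Omega> LO (grad F x) u lam (1 / real N) n = Some (y, m) \<and>
    approx_prox \<Omega> (grad F x) u lam (1 / real N) y \<and> real m \<le> real n + (4 * K + 1) * real N"
proof -
  have "0 < 1 / (4 * L)" using L_pos by simp
  with lam have "0 < lam" by linarith
  have "D\<^sup>2 / lam \<le> D\<^sup>2 / (1 / (4 * L))"
    using lam L_pos \<open>0 < lam\<close> by (intro divide_left_mono) auto
  then have "D\<^sup>2 / lam + G * D \<le> K" by (simp add: K_def mult.commute)
  with condg_terminates[OF compact convex assms(1) \<open>0 < lam\<close> _ D G[OF \<open>x \<in> \<Omega>\<close>] _ K_pos \<open>u \<in> \<Omega>\<close>,
      of "1 / real N" n] \<open>1 \<le> N\<close>
  obtain y m where "condg \<Omega> LO (grad F x) u lam (1 / real N) n = Some (y, m)"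
    "approx_prox \<Omega> (grad F x) u lam (1 / real N) y" "real m \<le> real n + 4 * K * real N + 1"
    by auto
  moreover from this(3) \<open>1 \<le> N\<close> have "real m \<le> real n + (4 * K + 1) * real N"
    by (simp add: distrib_right)
  ultimately show ?thesis by blast
qed

text \<open>Room for two inner loops of \<open>(4 * K + 1) * N\<close> calls each, as option II runs
  them; option I runs one.\<close>

definition lo_bound :: "nat \<Rightarrow> real" where "lo_bound N = (8 * K + 2) * real N"

section \<open>Complete runs, first in common and then for each option\<close>

text \<open>The part shared by both options: \<open>J\<close> is an additional invariant of the
  states, and \<open>err\<close> measures an iteration by the states before and after it.\<close>

lemma ncgs_rate:
  fixes err :: "'a ncgs_state \<Rightarrow> 'a ncgs_state \<Rightarrow> real"
  assumes "1 \<le> N" "\<theta>0 \<in> \<Omega>" and J0: "J \<lparr>it_theta = \<theta>0, it_ag = \<theta>0, it_md = \<theta>0, fo_calls = 0, lo_calls = 0\<rparr>"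
    and step: "\<And>k s. k < N \<Longrightarrow> it_theta s \<in> \<Omega> \<Longrightarrow> it_ag s \<in> \<Omega> \<Longrightarrow> J s \<Longrightarrow>
      \<exists>s'. ncgs_step FO LO \<Omega> rule \<alpha> \<beta> lam \<eta> (Suc k) s = Some s' \<and>
        it_theta s' \<in> \<Omega> \<and> it_ag s' \<in> \<Omega> \<and> J s' \<and> fo_calls s' = fo_calls s + 1 \<and>
        real (lo_calls s') \<le> real (lo_calls s) + lo_bound N \<and>
        F (it_ag s') \<le> F (it_ag s) + Q / real (Suc k) - 3 / (16 * L) * err s s'"
  shows "\<exists>s. (\<forall>k\<le>N. ncgs FO LO \<Omega> rule \<alpha> \<beta> lam \<eta> \<theta>0 k = Some (s k)) \<and>
    real (fo_calls (s N)) \<le> real N \<and> real (lo_calls (s N)) \<le> (8 * K + 2) * (real N)\<^sup>2 \<and>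
    (MIN k\<in>{1..N}. err (s (k - 1)) (s k)) \<le> 32 * L * (Q + B) / 3 / real N"
proof -
  let ?run = "ncgs FO LO \<Omega> rule \<alpha> \<beta> lam \<eta> \<theta>0"
  \<comment> \<open>The value of \<open>the\<close> is meaningful for \<open>k \<le> N\<close>,
    where the next claim shows that the run succeeds.\<close>
  define s where "s k = the (?run k)" for k
  have run: "?run k = Some (s k) \<and> it_theta (s k) \<in> \<Omega> \<and> it_ag (s k) \<in> \<Omega> \<and> J (s k) \<and>
      fo_calls (s k) = k \<and> real (lo_calls (s k)) \<le> real k * lo_bound N" if "k \<le> N" for k
    using that
  proof (induction k)
    case 0
    show ?case using \<open>\<theta>0 \<in> \<Omega>\<close> J0 by (simp add: s_def)
  next
    case (Suc k)
    then have IH: "?run k = Some (s k)" "it_theta (s k) \<in> \<Omega>" "it_ag (s k) \<in> \<Omega>" "J (s k)"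
      "fo_calls (s k) = k" "real (lo_calls (s k)) \<le> real k * lo_bound N" "k < N" by auto
    from step[OF IH(7,2-4)] obtain s' where
      s': "ncgs_step FO LO \<Omega> rule \<alpha> \<beta> lam \<eta> (Suc k) (s k) = Some s'"
        "it_theta s' \<in> \<Omega>" "it_ag s' \<in> \<Omega>" "J s'" "fo_calls s' = fo_calls (s k) + 1"
        "real (lo_calls s') \<le> real (lo_calls (s k)) + lo_bound N" by blast
    have "?run (Suc k) = Some s'" using IH(1) s'(1) by simp
    moreover from this have "s (Suc k) = s'" by (simp add: s_def)
    ultimately show ?case using s' IH(5,6) by (simp add: algebra_simps)
  qed
  have descent: "F (it_ag (s (Suc k))) \<le>
      F (it_ag (s k)) + Q / real (Suc k) - 3 / (16 * L) * err (s k) (s (Suc k))" if "k < N" for k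
  proof -
    from run[of k] that have IH: "?run k = Some (s k)" "it_theta (s k) \<in> \<Omega>" "it_ag (s k) \<in> \<Omega>" "J (s k)"
      by auto
    have "?run (Suc k) = Some (s (Suc k))" using run[of "Suc k"] that by auto
    with IH(1) have "ncgs_step FO LO \<Omega> rule \<alpha> \<beta> lam \<eta> (Suc k) (s k) = Some (s (Suc k))" by simp
    with step[OF that IH(2-4)] show ?thesis by auto
  qed
  \<comment> \<open>Used with \<open>A = Q\<close> and \<open>c = 3 / (16 * L)\<close>, which
    produces the constant \<open>32 * L * (Q + B) / 3\<close>.\<close>
  have "\<exists>k\<in>{1..N}. err (s (k - 1)) (s k) \<le> 2 * (Q + B) / (3 / (16 * L) * real N)"
  proof (rule exists_small_of_descent[where e = "\<lambda>k. F (it_ag (s k)) - Fmin"])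
    show "F (it_ag (s (Suc k))) - Fmin \<le> F (it_ag (s k)) - Fmin + Q / real (Suc k)
        - 3 / (16 * L) * err (s (Suc k - 1)) (s (Suc k))" if "k < N" for k
      using descent[OF that] by simp
    show "F (it_ag (s k)) - Fmin \<le> B" if "k < N" for k
      using B[of "it_ag (s k)"] run[of k] that by simp
    show "0 \<le> F (it_ag (s N)) - Fmin" using Fmin[of "it_ag (s N)"] run[of N] by simp
  qed (use \<open>1 \<le> N\<close> L_pos Q_ge B_nonneg in auto)
  then obtain k where k: "k \<in> {1..N}" "err (s (k - 1)) (s k) \<le> 32 * L * (Q + B) / 3 / real N"
    by (auto simp: field_simps)
  then have "(MIN k\<in>{1..N}. err (s (k - 1)) (s k)) \<le> 32 * L * (Q + B) / 3 / real N"
    by (intro order_trans[OF Min_le k(2)]) auto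
  moreover have "real (lo_calls (s N)) \<le> (8 * K + 2) * (real N)\<^sup>2"
    using run[of N] by (simp add: lo_bound_def power2_eq_square mult_ac)
  ultimately show ?thesis using run by (intro exI[of _ s]) auto
qed

text \<open>The invariant \<open>J\<close> forces the extrapolated point to be the previous iterate.
  As the two step sizes agree, the aggregate update returns the new iterate, which restores
  \<open>J\<close>.\<close>

lemma ncgs_rate_I:
  assumes LO: "linear_oracle \<Omega> LO" and "1 \<le> N" "\<theta>0 \<in> \<Omega>"
  shows "\<exists>s. (\<forall>k\<le>N. ncgs (grad F) LO \<Omega> Option_I (\<lambda>k. 2 / (real k + 1)) (\<lambda>k. 1 / (2 * L))
        (\<lambda>k. 1 / (2 * L)) (\<lambda>k. 1 / real N) \<theta>0 k = Some (s k)) \<and>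
    real (fo_calls (s N)) \<le> real N \<and> real (lo_calls (s N)) \<le> (8 * K + 2) * (real N)\<^sup>2 \<and>
    (MIN k\<in>{1..N}. (norm (grad_map \<Omega> (it_theta (s (k - 1))) (grad F (it_md (s k))) (1 / (2 * L))))\<^sup>2)
      \<le> 32 * L * (Q + B) / 3 / real N"
proof (rule ncgs_rate[where J = "\<lambda>s. it_ag s = it_theta s" and
      err = "\<lambda>s s'. (norm (grad_map \<Omega> (it_theta s) (grad F (it_md s')) (1 / (2 * L))))\<^sup>2"])
  fix k and s :: "'a ncgs_state"
  assume "k < N" and \<theta>: "it_theta s \<in> \<Omega>" and ag: "it_ag s = it_theta s"
  have "1 / (4 * L) \<le> 1 / (2 * L)" using L_pos by (simp add: field_simps)
  from condg_grad_terminates[OF LO \<theta> \<theta> this \<open>1 \<le> N\<close>] obtain y m where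
    y: "condg \<Omega> LO (grad F (it_theta s)) (it_theta s) (1 / (2 * L)) (1 / real N) (lo_calls s) = Some (y, m)"
      "approx_prox \<Omega> (grad F (it_theta s)) (it_theta s) (1 / (2 * L)) (1 / real N) y"
      "real m \<le> real (lo_calls s) + (4 * K + 1) * real N" by blast
  let ?s' = "\<lparr>it_theta = y, it_ag = y, it_md = it_theta s, fo_calls = fo_calls s + 1, lo_calls = m\<rparr>"
  have md: "(1 - a) *\<^sub>R it_theta s + a *\<^sub>R it_theta s = it_theta s" for a
    by (simp add: algebra_simps)
  have "ncgs_step (grad F) LO \<Omega> Option_I (\<lambda>k. 2 / (real k + 1)) (\<lambda>k. 1 / (2 * L))
      (\<lambda>k. 1 / (2 * L)) (\<lambda>k. 1 / real N) (Suc k) s = Some ?s'"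
    using y(1) L_pos unfolding ncgs_step_def Let_def ag md by simp
  moreover have "y \<in> \<Omega>" using y(2) by (simp add: approx_prox_def)
  moreover have "real m \<le> real (lo_calls s) + lo_bound N"
  proof -
    have "(4 * K + 1) * real N \<le> lo_bound N"
      unfolding lo_bound_def using K_pos by (intro mult_right_mono) auto
    with y(3) show ?thesis by linarith
  qed
  moreover have "F y \<le> F (it_theta s) + Q / real (Suc k)
      - 3 / (16 * L) * (norm (grad_map \<Omega> (it_theta s) (grad F (it_theta s)) (1 / (2 * L))))\<^sup>2"
  proof -
    have "5 / 2 * (1 / real N) \<le> Q * (1 / real (Suc k))"
      using Q_ge \<open>k < N\<close> by (intro mult_mono) (auto simp: field_simps)
    with approx_prox_descent[OF \<theta> y(2)] show ?thesis by simp
  qed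
  ultimately show "\<exists>s'. ncgs_step (grad F) LO \<Omega> Option_I (\<lambda>k. 2 / (real k + 1)) (\<lambda>k. 1 / (2 * L))
      (\<lambda>k. 1 / (2 * L)) (\<lambda>k. 1 / real N) (Suc k) s = Some s' \<and>
      it_theta s' \<in> \<Omega> \<and> it_ag s' \<in> \<Omega> \<and> it_ag s' = it_theta s' \<and> fo_calls s' = fo_calls s + 1 \<and>
      real (lo_calls s') \<le> real (lo_calls s) + lo_bound N \<and>
      F (it_ag s') \<le> F (it_ag s) + Q / real (Suc k)
        - 3 / (16 * L) * (norm (grad_map \<Omega> (it_theta s) (grad F (it_md s')) (1 / (2 * L))))\<^sup>2"
    using ag by (intro exI[of _ ?s']) simp
qed (use assms in auto)

text \<open>The decrease of \<open>F\<close> comes from the second inner loop, centred at the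
  extrapolated point; the first one supplies a feasible \<open>y\<close> for the next extrapolation,
  whose cost is paid by \<open>Q / k\<close>.\<close>

lemma ncgs_rate_II:
  assumes LO: "linear_oracle \<Omega> LO" and "1 \<le> N" "\<theta>0 \<in> \<Omega>"
  shows "\<exists>s. (\<forall>k\<le>N. ncgs (grad F) LO \<Omega> (Option_II (\<lambda>k. 1 / real N)) (\<lambda>k. 2 / (real k + 1))
        (\<lambda>k. 1 / (2 * L)) (\<lambda>k. real k * (1 / (2 * L)) / 2) (\<lambda>k. 1 / real N) \<theta>0 k = Some (s k)) \<and>
    real (fo_calls (s N)) \<le> real N \<and> real (lo_calls (s N)) \<le> (8 * K + 2) * (real N)\<^sup>2 \<and>
    (MIN k\<in>{1..N}. (norm (grad_map \<Omega> (it_md (s k)) (grad F (it_md (s k))) (1 / (2 * L))))\<^sup>2)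
      \<le> 32 * L * (Q + B) / 3 / real N"
proof (rule ncgs_rate[where J = "\<lambda>s. True" and
      err = "\<lambda>s s'. (norm (grad_map \<Omega> (it_md s') (grad F (it_md s')) (1 / (2 * L))))\<^sup>2"])
  fix k and s :: "'a ncgs_state"
  assume "k < N" and \<theta>: "it_theta s \<in> \<Omega>" and ag: "it_ag s \<in> \<Omega>"
  define a where "a = 2 / (real (Suc k) + 1)"
  have a: "0 \<le> a" "a \<le> 1" "a \<le> 2 / real (Suc k)" by (auto simp: a_def field_simps)
  define x where "x = (1 - a) *\<^sub>R it_ag s + a *\<^sub>R it_theta s"
  have x: "x \<in> \<Omega>" unfolding x_def using convexD_alt[OF convex ag \<theta>] a by simp
  \<comment> \<open>Equality holds in the first iteration, \<open>k = 0\<close> here; this smallest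
    step size dictates the \<open>4 * L\<close> in \<open>K\<close>.\<close>
  have "1 / (4 * L) \<le> real (Suc k) * (1 / (2 * L)) / 2" using L_pos by (simp add: field_simps)
  from condg_grad_terminates[OF LO x \<theta> this \<open>1 \<le> N\<close>] obtain y m where
    y: "condg \<Omega> LO (grad F x) (it_theta s) (real (Suc k) * (1 / (2 * L)) / 2) (1 / real N) (lo_calls s)
        = Some (y, m)"
      "approx_prox \<Omega> (grad F x) (it_theta s) (real (Suc k) * (1 / (2 * L)) / 2) (1 / real N) y"
      "real m \<le> real (lo_calls s) + (4 * K + 1) * real N" by blast
  have "1 / (4 * L) \<le> 1 / (2 * L)" using L_pos by (simp add: field_simps)
  from condg_grad_terminates[OF LO x x this \<open>1 \<le> N\<close>] obtain z n where
    z: "condg \<Omega> LO (grad F x) x (1 / (2 * L)) (1 / real N) m = Some (z, n)"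
      "approx_prox \<Omega> (grad F x) x (1 / (2 * L)) (1 / real N) z"
      "real n \<le> real m + (4 * K + 1) * real N" by blast
  let ?s' = "\<lparr>it_theta = y, it_ag = z, it_md = x, fo_calls = fo_calls s + 1, lo_calls = n\<rparr>"
  have "ncgs_step (grad F) LO \<Omega> (Option_II (\<lambda>k. 1 / real N)) (\<lambda>k. 2 / (real k + 1))
      (\<lambda>k. 1 / (2 * L)) (\<lambda>k. real k * (1 / (2 * L)) / 2) (\<lambda>k. 1 / real N) (Suc k) s = Some ?s'"
    unfolding ncgs_step_def Let_def a_def[symmetric] x_def[symmetric] y(1) by (simp add: z(1))
  moreover have "y \<in> \<Omega>" "z \<in> \<Omega>" using y(2) z(2) by (auto simp: approx_prox_def)
  moreover have "real n \<le> real (lo_calls s) + lo_bound N"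
    using y(3) z(3) by (simp add: lo_bound_def distrib_right)
  moreover have "F z \<le> F (it_ag s) + Q / real (Suc k)
      - 3 / (16 * L) * (norm (grad_map \<Omega> x (grad F x) (1 / (2 * L))))\<^sup>2"
  proof -
    have "a * (G * D + L / 2 * D\<^sup>2) \<le> 2 / real (Suc k) * (G * D + L / 2 * D\<^sup>2)"
      using a G_nonneg D_nonneg L_pos by (intro mult_right_mono) auto
    moreover have "5 / 2 * (1 / real N) \<le> 5 / 2 * (1 / real (Suc k))"
      using \<open>k < N\<close> by (intro mult_left_mono) (auto simp: field_simps)
    moreover have "Q / real (Suc k) = 5 / 2 * (1 / real (Suc k)) + 2 / real (Suc k) * (G * D + L / 2 * D\<^sup>2)"
    proof -
      have "Q = 5 / 2 + 2 * (G * D + L / 2 * D\<^sup>2)" by (simp add: Q_def algebra_simps)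
      then show ?thesis by (simp add: add_divide_distrib)
    qed
    ultimately show ?thesis
      using approx_prox_descent[OF x z(2)] F_extrapolation_le[OF ag \<theta> a(1,2)]
      unfolding x_def[symmetric] by linarith
  qed
  ultimately show "\<exists>s'. ncgs_step (grad F) LO \<Omega> (Option_II (\<lambda>k. 1 / real N)) (\<lambda>k. 2 / (real k + 1))
      (\<lambda>k. 1 / (2 * L)) (\<lambda>k. real k * (1 / (2 * L)) / 2) (\<lambda>k. 1 / real N) (Suc k) s = Some s' \<and>
      it_theta s' \<in> \<Omega> \<and> it_ag s' \<in> \<Omega> \<and> True \<and> fo_calls s' = fo_calls s + 1 \<and>
      real (lo_calls s') \<le> real (lo_calls s) + lo_bound N \<and>
      F (it_ag s') \<le> F (it_ag s) + Q / real (Suc k)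
        - 3 / (16 * L) * (norm (grad_map \<Omega> (it_md s') (grad F (it_md s')) (1 / (2 * L))))\<^sup>2"
    by (intro exI[of _ ?s']) simp
qed (use assms in auto)

end

subsection \<open>Oracle complexity\<close>

text \<open>Taking \<open>N\<close> of order \<open>1 / \<epsilon>\<close> balances the rate
  \<open>E / N\<close> against the costs \<open>N\<close> and \<open>A * N\<^sup>2\<close>. This
  \<open>N\<close> is fixed before the oracle, so it works for all of them.\<close>

lemma complexity_of_rate:
  fixes fo lo :: "nat \<Rightarrow> 's \<Rightarrow> nat" and err :: "nat \<Rightarrow> 's \<Rightarrow> real"
  assumes rate: "\<And>N LO. 1 \<le> N \<Longrightarrow> P LO \<Longrightarrow> \<exists>s. run N LO s \<and> real (fo N s) \<le> real N \<and>
      real (lo N s) \<le> A * (real N)\<^sup>2 \<and> err N s \<le> E / real N"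
    and "0 \<le> A"
  shows "\<exists>C::real. \<forall>\<epsilon>::real. 0 < \<epsilon> \<and> \<epsilon> \<le> 1 \<longrightarrow> (\<exists>N::nat. N \<ge> 1 \<and>
    (\<forall>LO. P LO \<longrightarrow> (\<exists>s. run N LO s \<and> real (fo N s) \<le> C / \<epsilon> \<and> real (lo N s) \<le> C / \<epsilon>\<^sup>2 \<and> err N s \<le> \<epsilon>)))"
proof -
  \<comment> \<open>With \<open>E' \<ge> 1\<close> and \<open>\<epsilon> \<le> 1\<close> the
    quotient \<open>E' / \<epsilon>\<close> is at least 1, so rounding up at most doubles
    it.\<close>
  define E' where "E' = max E 1"
  define C where "C = 2 * E' + A * (2 * E')\<^sup>2"
  have E': "E \<le> E'" "1 \<le> E'" by (auto simp: E'_def)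
  have C: "2 * E' \<le> C" "A * (2 * E')\<^sup>2 \<le> C" using E' \<open>0 \<le> A\<close> by (auto simp: C_def)
  show ?thesis
  proof (intro exI[of _ C] allI impI)
    fix \<epsilon> :: real assume \<epsilon>: "0 < \<epsilon> \<and> \<epsilon> \<le> 1"
    define N where "N = nat \<lceil>E' / \<epsilon>\<rceil>"
    have "1 \<le> E' / \<epsilon>" using \<epsilon> E' by (simp add: field_simps)
    then have N: "E' / \<epsilon> \<le> real N" "real N \<le> 2 * E' / \<epsilon>" unfolding N_def by linarith+
    then have "1 \<le> N" using \<open>1 \<le> E' / \<epsilon>\<close> by linarith
    show "\<exists>N\<ge>1. \<forall>LO. P LO \<longrightarrow>
        (\<exists>s. run N LO s \<and> real (fo N s) \<le> C / \<epsilon> \<and> real (lo N s) \<le> C / \<epsilon>\<^sup>2 \<and> err N s \<le> \<epsilon>)"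
    proof (intro exI[of _ N] conjI allI impI)
      fix LO assume "P LO"
      from rate[OF \<open>1 \<le> N\<close> this] obtain s where s: "run N LO s" "real (fo N s) \<le> real N"
        "real (lo N s) \<le> A * (real N)\<^sup>2" "err N s \<le> E / real N" by blast
      have "real N \<le> C / \<epsilon>"
        using N(2) divide_right_mono[OF C(1), of \<epsilon>] \<epsilon> by simp
      moreover have "A * (real N)\<^sup>2 \<le> C / \<epsilon>\<^sup>2"
      proof -
        have "A * (real N)\<^sup>2 \<le> A * (2 * E' / \<epsilon>)\<^sup>2"
          using N(2) \<open>0 \<le> A\<close> by (intro mult_left_mono power_mono) auto
        also have "\<dots> = A * (2 * E')\<^sup>2 / \<epsilon>\<^sup>2" by (simp add: power_divide)
        also have "\<dots> \<le> C / \<epsilon>\<^sup>2" using C(2) by (intro divide_right_mono) auto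
        finally show ?thesis .
      qed
      moreover have "E / real N \<le> \<epsilon>"
        using N(1) \<epsilon> E'(1) \<open>1 \<le> N\<close> by (simp add: field_simps)
      ultimately show "\<exists>s. run N LO s \<and> real (fo N s) \<le> C / \<epsilon> \<and> real (lo N s) \<le> C / \<epsilon>\<^sup>2 \<and> err N s \<le> \<epsilon>"
        using s by (intro exI[of _ s]) auto
    qed fact
  qed
qed

theorem corollary1:
  fixes \<Omega> :: "(real ^ 'p) set" and F :: "real ^ 'p \<Rightarrow> real"
    and L l M :: real and \<theta>0 \<theta>star :: "real ^ 'p"
  assumes "\<Omega> \<noteq> {}" and "compact \<Omega>" and "convex \<Omega>"
    and "\<And>x. F differentiable (at x)"
    and "L > 0" and "smooth_on L \<Omega> F"
    and "l \<ge> 0" and "lower_smooth_on l \<Omega> F"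
    and "\<And>x \<omega> \<gamma>. x \<in> \<Omega> \<Longrightarrow> \<gamma> > 0 \<Longrightarrow> norm (prox \<Omega> x \<omega> \<gamma>) \<le> M"
    and "\<theta>0 \<in> \<Omega>"
    and "is_arg_min F (\<lambda>\<theta>. \<theta> \<in> \<Omega>) \<theta>star"
  shows
    "(\<exists>C::real. \<forall>\<epsilon>::real. 0 < \<epsilon> \<and> \<epsilon> \<le> 1 \<longrightarrow>
       (\<exists>N::nat. N \<ge> 1 \<and>
         (\<forall>LO. linear_oracle \<Omega> LO \<longrightarrow>
           (\<exists>s.
             (\<forall>k\<le>N.
               ncgs (grad F) LO \<Omega> Option_I (\<lambda>k. 2 / (real k + 1)) (\<lambda>k. 1 / (2 * L))
                 (\<lambda>k. 1 / (2 * L)) (\<lambda>k. 1 / real N) \<theta>0 k = Some (s k)) \<and>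
             real (fo_calls (s N)) \<le> C / \<epsilon> \<and>
             real (lo_calls (s N)) \<le> C / \<epsilon>\<^sup>2 \<and>
             (MIN k\<in>{1..N}. (norm (grad_map \<Omega> (it_theta (s (k - 1)))
                (grad F (it_md (s k))) (1 / (2 * L))))\<^sup>2) \<le> \<epsilon>))))
     \<and>
     (\<exists>C::real. \<forall>\<epsilon>::real. 0 < \<epsilon> \<and> \<epsilon> \<le> 1 \<longrightarrow>
       (\<exists>N::nat. N \<ge> 1 \<and>
         (\<forall>LO. linear_oracle \<Omega> LO \<longrightarrow>
           (\<exists>s.
             (\<forall>k\<le>N.
               ncgs (grad F) LO \<Omega> (Option_II (\<lambda>k. 1 / real N)) (\<lambda>k. 2 / (real k + 1))
                 (\<lambda>k. 1 / (2 * L)) (\<lambda>k. real k * (1 / (2 * L)) / 2) (\<lambda>k. 1 / real N) \<theta>0 k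
                 = Some (s k)) \<and>
             real (fo_calls (s N)) \<le> C / \<epsilon> \<and>
             real (lo_calls (s N)) \<le> C / \<epsilon>\<^sup>2 \<and>
             (MIN k\<in>{1..N}. (norm (grad_map \<Omega> (it_md (s k))
                (grad F (it_md (s k))) (1 / (2 * L))))\<^sup>2) \<le> \<epsilon>))))"
proof -
  have F_cont: "continuous_on \<Omega> F"
    using assms(4) by (intro differentiable_imp_continuous_on)
      (auto simp: differentiable_on_def intro: differentiable_at_withinI)
  obtain x0 where x0: "x0 \<in> \<Omega>" using \<open>\<Omega> \<noteq> {}\<close> by blast
  obtain xmax where xmax: "xmax \<in> \<Omega>" "\<And>x. x \<in> \<Omega> \<Longrightarrow> F x \<le> F xmax"
    using continuous_attains_sup[OF \<open>compact \<Omega>\<close> \<open>\<Omega> \<noteq> {}\<close> F_cont] by blast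
  have star: "\<theta>star \<in> \<Omega>" "\<And>x. x \<in> \<Omega> \<Longrightarrow> F \<theta>star \<le> F x"
    using assms(11) by (auto simp: is_arg_min_linorder)
  define D where "D = diameter \<Omega>"
  have D: "norm (x - y) \<le> D" if "x \<in> \<Omega>" "y \<in> \<Omega>" for x y
    using diameter_bounded_bound[OF compact_imp_bounded[OF \<open>compact \<Omega>\<close>] that]
    by (simp add: D_def dist_norm)
  \<comment> \<open>Lipschitz continuity of the gradient, anchored at one point of the bounded set
    \<open>\<Omega>\<close>, bounds the gradient throughout \<open>\<Omega>\<close>.\<close>
  define G where "G = norm (grad F x0) + L * D"
  have G: "norm (grad F x) \<le> G" if "x \<in> \<Omega>" for x
  proof -
    have "norm (grad F x - grad F x0) \<le> L * norm (x - x0)"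
      using \<open>smooth_on L \<Omega> F\<close> that x0 by (simp add: smooth_on_def)
    also have "\<dots> \<le> L * D" using D that x0 \<open>L > 0\<close> by (intro mult_left_mono) auto
    finally show ?thesis
      unfolding G_def using norm_triangle_sub[of "grad F x" "grad F x0"] by linarith
  qed
  interpret ncgs_problem \<Omega> F L G D "F \<theta>star" "F xmax - F \<theta>star"
  proof
    show "0 \<le> D" using D[OF x0 x0] by simp
    show "0 \<le> G" using norm_ge_zero G[OF x0] by (rule order_trans)
  qed (use assms G D xmax star in auto)
  have K: "0 \<le> 8 * K + 2" using K_pos by simp
  note rate_I = ncgs_rate_I[OF _ _ \<open>\<theta>0 \<in> \<Omega>\<close>] and rate_II = ncgs_rate_II[OF _ _ \<open>\<theta>0 \<in> \<Omega>\<close>]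
  show ?thesis
  proof (rule conjI, goal_cases)
    case 1
    show ?case
      by (rule complexity_of_rate[where fo = "\<lambda>N s. fo_calls (s N)" and lo = "\<lambda>N s. lo_calls (s N)",
            OF rate_I K])
  next
    case 2
    show ?case
      by (rule complexity_of_rate[where fo = "\<lambda>N s. fo_calls (s N)" and lo = "\<lambda>N s. lo_calls (s N)",
            OF rate_II K])
  qed
qed

end
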